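(* Let $\mu,\alpha\in\mathbb{R}$ and consider the autonomous one-degree-of-freedom Hamiltonian system $x'=\partial H/\partial y$, $y'=-\partial H/\partial x$ with $$H(x,y)=\tfrac12 y^2-\alpha\cos x-\tfrac{\mu}{2}\log(7+\cos 2x).$$ The points $P_1=(0,0)$ and $P_2=(\pi,0)$ are equilibria for every choice of $\mu,\alpha$. Moreover: (i) $P_1$ is stable if $\mu>-4\alpha$ and unstable if $\mu<-4\alpha$; (ii) $P_2$ is stable if $\mu>4\alpha$ and unstable if $\mu<4\alpha$.
   Context: This is the case $\varepsilon=0$ (fixed suspension point) of the charged pendulum Hamiltonian $H(x,y,\tau)=\frac12 y^2-\alpha\cos x-\varepsilon\cos\tau\cos x-\frac{\mu}{2}\log(7+\cos 2x)$. Stability is in the sense of Lyapunov. *)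

theory Defs
  imports "HOL-Analysis.Analysis"
begin

definition charged_pendulum_H :: "real \<Rightarrow> real \<Rightarrow> real \<Rightarrow> real \<Rightarrow> real" where
  "charged_pendulum_H \<mu> \<alpha> x y = y\<^sup>2 / 2 - \<alpha> * cos x - \<mu> / 2 * ln (7 + cos (2 * x))"

definition hamiltonian_field :: "(real \<Rightarrow> real \<Rightarrow> real) \<Rightarrow> real \<times> real \<Rightarrow> real \<times> real" where
  "hamiltonian_field H = (\<lambda>(x, y). (deriv (\<lambda>v. H x v) y, - deriv (\<lambda>u. H u y) x))"

definition charged_pendulum_field :: "real \<Rightarrow> real \<Rightarrow> real \<times> real \<Rightarrow> real \<times> real" where
  "charged_pendulum_field \<mu> \<alpha> = hamiltonian_field (charged_pendulum_H \<mu> \<alpha>)"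

definition equilibrium :: "('a::real_normed_vector \<Rightarrow> 'a) \<Rightarrow> 'a \<Rightarrow> bool" where
  "equilibrium f p \<longleftrightarrow> f p = 0"

definition solution_upto :: "('a::real_normed_vector \<Rightarrow> 'a) \<Rightarrow> real \<Rightarrow> (real \<Rightarrow> 'a) \<Rightarrow> bool" where
  "solution_upto f T z \<longleftrightarrow>
     (\<forall>t\<in>{0..T}. (z has_vector_derivative f (z t)) (at t within {0..T}))"

(* Solutions on all compact intervals [0,T] are considered, so that no solution is
   disregarded for not being known to extend to [0,\<infinity>). For a locally Lipschitz field
   in finite dimension this is the usual notion: solutions trapped in a ball extend to
   all t \<ge> 0. On real \<times> real the metric dist is the Euclidean one. *)
definition lyapunov_stable :: "('a::real_normed_vector \<Rightarrow> 'a) \<Rightarrow> 'a \<Rightarrow> bool" where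
  "lyapunov_stable f p \<longleftrightarrow>
     (\<forall>\<epsilon>>0. \<exists>\<delta>>0. \<forall>T\<ge>0. \<forall>z. solution_upto f T z \<longrightarrow> dist (z 0) p < \<delta> \<longrightarrow>
        (\<forall>t\<in>{0..T}. dist (z t) p < \<epsilon>))"

abbreviation lyapunov_unstable :: "('a::real_normed_vector \<Rightarrow> 'a) \<Rightarrow> 'a \<Rightarrow> bool" where
  "lyapunov_unstable f p \<equiv> \<not> lyapunov_stable f p"

end

theory Submission
  imports Defs
begin

text \<open>
  The energy is a first integral. Where the potential has a strict minimum it confines nearby
  orbits to small sublevel sets; this is a statement about given solutions and needs no existence
  theorem. Where the potential has a strict local maximum from the right, the orbit on the energy
  level of the equilibrium, \<open>x' = \<surd>(2 (V a - V x))\<close>, is obtained by separation of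
  variables. It starts arbitrarily close to the equilibrium and travels a fixed distance in
  finite time.
\<close>

section \<open>Lyapunov's direct method with a first integral\<close>

lemma solution_upto_continuous_on:
  assumes "solution_upto f T z"
  shows "continuous_on {0..T} z"
  using assms unfolding solution_upto_def continuous_on_eq_continuous_within
  by (blast intro: has_vector_derivative_continuous)

text \<open>On a small sphere around \<open>p\<close> the minimum of \<open>L\<close> exceeds
  \<open>L p\<close>, and near \<open>p\<close> continuity keeps \<open>L\<close> below that
  minimum. Since \<open>L\<close> is constant along solutions, an orbit starting there can never
  meet the sphere.\<close>

lemma lyapunov_stable_if_strict_min_first_integral:
  fixes f :: "'a::euclidean_space \<Rightarrow> 'a" and L :: "'a \<Rightarrow> real"
  assumes cont: "continuous_on UNIV L"
    and first_integral: "\<And>T z t. solution_upto f T z \<Longrightarrow> t \<in> {0..T} \<Longrightarrow> L (z t) = L (z 0)"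
    and "r > 0"
    and strict_min: "\<And>w. w \<noteq> p \<Longrightarrow> dist w p \<le> r \<Longrightarrow> L p < L w"
  shows "lyapunov_stable f p"
  unfolding lyapunov_stable_def
proof (intro allI impI)
  fix \<epsilon> :: real assume "\<epsilon> > 0"
  \<comment> \<open>The bound \<open>r\<close> keeps the sphere where \<open>p\<close> is the strict
    minimizer; the bound \<epsilon> makes every orbit that leaves the \<epsilon>-ball cross the
    sphere.\<close>
  define \<rho> where "\<rho> = min r \<epsilon>"
  have \<rho>: "\<rho> > 0" "\<rho> \<le> r" "\<rho> \<le> \<epsilon>" using \<open>\<epsilon> > 0\<close> \<open>r > 0\<close> by (auto simp: \<rho>_def)
  obtain w0 where w0: "w0 \<in> sphere p \<rho>" "\<And>w. w \<in> sphere p \<rho> \<Longrightarrow> L w0 \<le> L w"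
    using continuous_attains_inf[of "sphere p \<rho>" L] \<rho>(1) continuous_on_subset[OF cont]
    by (metis compact_sphere less_eq_real_def sphere_eq_empty subset_UNIV not_less)
  have "L p < L w0"
    using w0(1) \<rho> by (intro strict_min) (auto simp: dist_commute)
  moreover have "isCont L p"
    using cont by (simp add: continuous_on_eq_continuous_at)
  ultimately obtain d where d: "d > 0" "\<And>w. dist w p < d \<Longrightarrow> L w < L w0"
    using order_tendstoD(2)[of L "L p" "nhds p" "L w0"]
    by (auto simp: isCont_def tendsto_at_iff_tendsto_nhds eventually_nhds_metric)
  show "\<exists>\<delta>>0. \<forall>T\<ge>0. \<forall>z. solution_upto f T z \<longrightarrow> dist (z 0) p < \<delta> \<longrightarrow>
      (\<forall>t\<in>{0..T}. dist (z t) p < \<epsilon>)"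
  \<comment> \<open>Closeness \<open>d\<close> bounds the initial value of \<open>L\<close>;
    closeness \<rho> starts the orbit inside the sphere, so that an escape yields a crossing
    time.\<close>
  proof (intro exI[of _ "min d \<rho>"] conjI allI impI ballI)
    fix T z t
    assume z: "solution_upto f T z" "dist (z 0) p < min d \<rho>" and t: "t \<in> {0..T}"
    show "dist (z t) p < \<epsilon>"
    proof (rule ccontr)
      assume "\<not> dist (z t) p < \<epsilon>"
      moreover have "continuous_on {0..t} (\<lambda>s. dist (z s) p)"
        using solution_upto_continuous_on[OF z(1)] t
        by (intro continuous_intros) (auto elim: continuous_on_subset)
      ultimately obtain s where s: "0 \<le> s" "s \<le> t" "dist (z s) p = \<rho>"
        using IVT'[of "\<lambda>s. dist (z s) p" 0 \<rho> t] z(2) t \<rho> by auto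
      have "L w0 \<le> L (z s)" using s(3) by (intro w0(2)) (simp add: dist_commute)
      also have "\<dots> = L (z 0)" using s t by (intro first_integral[OF z(1)]) auto
      also have "\<dots> < L w0" using z(2) by (intro d(2)) simp
      finally show False by simp
    qed
  qed (use d \<rho> in auto)
qed

section \<open>Newton equations: conservation of energy and stability\<close>

definition newton_field :: "(real \<Rightarrow> real) \<Rightarrow> real \<times> real \<Rightarrow> real \<times> real" where
  "newton_field v = (\<lambda>(x, y). (y, - v x))"

text \<open>Along a solution \<open>(x, y)\<close> the kinetic term changes at the rate
  \<open>- y * v x\<close> and the potential term at the rate \<open>v x * y\<close>.\<close>

lemma newton_field_energy_conserved:
  assumes V: "\<And>x. (V has_real_derivative v x) (at x)"
    and z: "solution_upto (newton_field v) T z" and t: "t \<in> {0..T}"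
  shows "(snd (z t))\<^sup>2 / 2 + V (fst (z t)) = (snd (z 0))\<^sup>2 / 2 + V (fst (z 0))"
proof -
  have "((\<lambda>t. (snd (z t))\<^sup>2 / 2 + V (fst (z t))) has_real_derivative 0) (at s within {0..T})"
    if s: "s \<in> {0..T}" for s
  proof -
    have der: "(z has_vector_derivative newton_field v (z s)) (at s within {0..T})"
      using z s by (auto simp: solution_upto_def)
    have x: "((\<lambda>t. fst (z t)) has_real_derivative snd (z s)) (at s within {0..T})"
      using bounded_linear.has_vector_derivative[OF bounded_linear_fst der]
      by (simp add: has_real_derivative_iff_has_vector_derivative newton_field_def split_beta)
    have y: "((\<lambda>t. snd (z t)) has_real_derivative - v (fst (z s))) (at s within {0..T})"
      using bounded_linear.has_vector_derivative[OF bounded_linear_snd der]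
      by (simp add: has_real_derivative_iff_has_vector_derivative newton_field_def split_beta)
    show ?thesis
      by (auto intro!: derivative_eq_intros y DERIV_chain2[OF V x])
  qed
  then have "\<exists>c. \<forall>s\<in>{0..T}. (snd (z s))\<^sup>2 / 2 + V (fst (z s)) = c"
    by (intro has_field_derivative_zero_constant convex_real_interval)
  moreover have "0 \<in> {0..T}" using t by simp
  ultimately show ?thesis using t by metis
qed

lemma newton_field_stable_if_strict_local_min:
  assumes V: "\<And>x. (V has_real_derivative v x) (at x)"
    and "r > 0" and strict_min: "\<And>x. x \<noteq> a \<Longrightarrow> \<bar>x - a\<bar> \<le> r \<Longrightarrow> V a < V x"
  shows "lyapunov_stable (newton_field v) (a, 0)"
proof (rule lyapunov_stable_if_strict_min_first_integral[OF _ _ \<open>r > 0\<close>])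
  have "continuous_on UNIV V"
    using V by (meson DERIV_isCont continuous_at_imp_continuous_on)
  then show "continuous_on UNIV (\<lambda>w. (snd w)\<^sup>2 / 2 + V (fst w))"
    by (intro continuous_intros continuous_on_compose2[OF \<open>continuous_on UNIV V\<close>]) auto
next
  fix w :: "real \<times> real" assume w: "w \<noteq> (a, 0)" "dist w (a, 0) \<le> r"
  obtain x y where [simp]: "w = (x, y)" by (cases w)
  have "\<bar>x - a\<bar> \<le> r"
    using dist_fst_le[of w "(a, 0)"] w(2) by (simp add: dist_real_def)
  \<comment> \<open>Off the line \<open>x = a\<close> the potential makes the inequality strict; on
    it \<open>y\<close> is nonzero and the kinetic term does.\<close>
  then show "(snd (a, 0))\<^sup>2 / 2 + V (fst (a, 0)) < (snd w)\<^sup>2 / 2 + V (fst w)"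
    using strict_min[of x] w(1) by (cases "x = a") (auto simp: add_nonneg_pos add_strict_increasing2)
qed (rule newton_field_energy_conserved[OF V])

section \<open>Instability: escape along the energy level\<close>

text \<open>Separation of variables for \<open>x' = g x\<close>: the travel time is strictly
  increasing in the position because \<open>g\<close> is positive, and its inverse is the motion.
  The margins \<open>l < p\<close> and \<open>q < u\<close> make the derivatives two-sided even at
  the end times.\<close>

lemma separable_solution_exists:
  fixes g :: "real \<Rightarrow> real"
  assumes g: "continuous_on {l..u} g" "\<And>s. s \<in> {l..u} \<Longrightarrow> g s > 0"
    and lpqu: "l < p" "p \<le> q" "q < u"
  obtains T x where "T \<ge> 0" "x 0 = p" "x T = q"
    "\<And>t. t \<in> {0..T} \<Longrightarrow> x t \<in> {p..q}"
    "\<And>t. t \<in> {0..T} \<Longrightarrow> (x has_real_derivative g (x t)) (at t)"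
proof -
  \<comment> \<open>\<open>F x\<close> is the time needed to travel from \<open>l\<close> to
    \<open>x\<close> at speed \<open>g\<close>.\<close>
  define F where "F = (\<lambda>x. integral {l..x} (\<lambda>s. 1 / g s))"
  have F: "(F has_real_derivative 1 / g s) (at s within {l..u})" if "s \<in> {l..u}" for s
    unfolding F_def using that g
    by (intro integral_has_real_derivative continuous_intros) force+
  have F_at: "(F has_real_derivative 1 / g s) (at s)" if "s \<in> {l<..<u}" for s
    using F[of s] that at_within_Icc_at[of l s u] by simp
  have contF: "continuous_on {l..u} F"
    using F by (meson DERIV_continuous_on)
  have mono: "F s < F s'" if "l \<le> s" "s < s'" "s' \<le> u" for s s'
  proof (rule DERIV_pos_imp_increasing_open[OF \<open>s < s'\<close>])
    show "\<exists>y. DERIV F x :> y \<and> y > 0" if "s < x" "x < s'" for x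
      using F_at[of x] g(2)[of x] that \<open>l \<le> s\<close> \<open>s' \<le> u\<close> by fastforce
    show "continuous_on {s..s'} F"
      using contF that by (auto elim: continuous_on_subset)
  qed
  have inj: "inj_on F {l..u}"
    by (rule linorder_inj_onI') (use mono in force)
  define h where "h = the_inv_into {l..u} F"
  have hF: "h (F s) = s" if "s \<in> {l..u}" for s
    unfolding h_def by (rule the_inv_into_f_f[OF inj that])
  have image: "\<exists>s\<in>{l'..u'}. F s = y" if "y \<in> {F l'..F u'}" "l \<le> l'" "l' \<le> u'" "u' \<le> u" for y l' u'
    using IVT'[of F l' y u'] that continuous_on_subset[OF contF, of "{l'..u'}"] by auto
  have "{F l..F u} \<subseteq> F ` {l..u}"
    using image[of _ l u] lpqu by force
  then have conth: "continuous_on {F l..F u} h"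
    using continuous_on_inv_into[OF contF _ inj] by (auto simp: h_def elim: continuous_on_subset)
  have h_der: "(h has_real_derivative g (h y)) (at y)" and h_in: "h y \<in> {p..q}"
    if y: "y \<in> {F p..F q}" for y
  proof -
    obtain s where s: "s \<in> {p..q}" "y = F s" using image[OF y] lpqu by auto
    then have hy: "h y = s" using hF[of s] lpqu by auto
    then show "h y \<in> {p..q}" using s by simp
    \<comment> \<open>The inverse function rule needs \<open>F (h y') = y'\<close> on an open
      interval around \<open>y\<close>; the margins around \<open>p\<close> and \<open>q\<close>
      provide it.\<close>
    have "F l < y" "y < F u" using mono[of l s] mono[of s u] s lpqu by auto
    then have "(h has_real_derivative inverse (1 / g (h y))) (at y)"
    proof (rule DERIV_inverse_function[rotated 2])
      show "(F has_real_derivative 1 / g (h y)) (at (h y))"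
        using s lpqu hy by (intro F_at) auto
      show "1 / g (h y) \<noteq> 0" using g(2)[of s] s hy lpqu by auto
      show "F (h y') = y'" if "F l < y'" "y' < F u" for y'
        using image[of y' l u] that lpqu hF by force
      show "isCont h y"
        using \<open>F l < y\<close> \<open>y < F u\<close> by (intro continuous_on_interior[OF conth]) simp
    qed
    then show "(h has_real_derivative g (h y)) (at y)" by simp
  qed
  \<comment> \<open>The clock is shifted by \<open>F p\<close>, so that time 0 finds the motion at
    \<open>p\<close>.\<close>
  show thesis
  proof (rule that[of "F q - F p" "\<lambda>t. h (F p + t)"])
    show "F q - F p \<ge> 0" using mono[of p q] lpqu by (cases "p = q") auto
    show "h (F p + 0) = p" "h (F p + (F q - F p)) = q" using hF lpqu by auto
    fix t assume t: "t \<in> {0..F q - F p}"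
    show "h (F p + t) \<in> {p..q}" using t by (intro h_in) auto
    have "(h has_real_derivative g (h (F p + t))) (at (F p + t))"
      using t by (intro h_der) auto
    then show "((\<lambda>t. h (F p + t)) has_real_derivative g (h (F p + t))) (at t)"
      using DERIV_shift[of h _ t "F p"] by (simp add: add.commute)
  qed
qed

text \<open>Stability is refuted with tolerance \<open>r / 2\<close>: orbits on the level
  \<open>y\<^sup>2 / 2 + V x = V a\<close> with \<open>y > 0\<close> move right and reach
  \<open>x = a + r / 2\<close>, however close to \<open>(a, 0)\<close> they start.\<close>

lemma newton_field_unstable_if_strict_right_max:
  assumes V: "\<And>x. (V has_real_derivative v x) (at x)"
    and "r > 0" and strict_max: "\<And>x. a < x \<Longrightarrow> x < a + r \<Longrightarrow> V x < V a"
  shows "lyapunov_unstable (newton_field v) (a, 0)"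
proof
  assume "lyapunov_stable (newton_field v) (a, 0)"
  then obtain \<delta> where \<delta>: "\<delta> > 0" and stable:
    "\<And>T z. T \<ge> 0 \<Longrightarrow> solution_upto (newton_field v) T z \<Longrightarrow> dist (z 0) (a, 0) < \<delta> \<Longrightarrow>
       \<forall>t\<in>{0..T}. dist (z t) (a, 0) < r / 2"
    unfolding lyapunov_stable_def using \<open>r > 0\<close> by (meson half_gt_zero)
  define g where "g s = sqrt (2 * (V a - V s))" for s
  have contV: "continuous_on S V" for S
    using V by (meson DERIV_isCont continuous_at_imp_continuous_on)
  have contg: "continuous_on S g" for S
    unfolding g_def by (intro continuous_intros contV)
  have g_pos: "g s > 0" if "a < s" "s < a + r" for s
    using strict_max[OF that] by (simp add: g_def)
  have g_der: "(g has_real_derivative - v s / g s) (at s)" if "a < s" "s < a + r" for s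
    using strict_max[OF that] unfolding g_def
    by (auto intro!: derivative_eq_intros V simp: field_simps)
  \<comment> \<open>As \<open>g a = 0\<close>, the points \<open>(p, g p)\<close> of the level tend
    to the equilibrium when \<open>p\<close> decreases to \<open>a\<close>, so one of them is a
    start within \<delta>.\<close>
  have "(g \<longlongrightarrow> g a) (at_right a)"
    using contg[of UNIV] continuous_at_imp_continuous_at_within[of a g "{a<..}"]
    by (simp add: continuous_on_eq_continuous_at continuous_within)
  then have "((\<lambda>s. (s, g s)) \<longlongrightarrow> (a, 0)) (at_right a)"
    by (intro tendsto_Pair tendsto_ident_at) (simp add: g_def[of a])
  then have "\<forall>\<^sub>F s in at_right a. dist (s, g s) (a, 0) < \<delta>"
    using \<delta> by (rule tendstoD)
  moreover have "\<forall>\<^sub>F s in at_right a. s \<in> {a<..<a + r / 2}"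
    using \<open>r > 0\<close> by (intro eventually_at_right_real) simp
  ultimately have "\<forall>\<^sub>F s in at_right a. dist (s, g s) (a, 0) < \<delta> \<and> s \<in> {a<..<a + r / 2}"
    by (rule eventually_conj)
  then obtain p where p: "dist (p, g p) (a, 0) < \<delta>" "a < p" "p < a + r / 2"
    using eventually_happens'[OF trivial_limit_at_right_real] by force
  obtain T x where x: "T \<ge> 0" "x 0 = p" "x T = a + r / 2"
    "\<And>t. t \<in> {0..T} \<Longrightarrow> x t \<in> {p..a + r / 2}"
    "\<And>t. t \<in> {0..T} \<Longrightarrow> (x has_real_derivative g (x t)) (at t)"
  \<comment> \<open>The ends \<open>(a + p) / 2\<close> and \<open>a + 3 / 4 * r\<close> leave room
    around \<open>p\<close> and \<open>a + r / 2\<close> while staying inside the interval from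
    \<open>a\<close> to \<open>a + r\<close>, where \<open>g\<close> is positive.\<close>
  proof (rule separable_solution_exists[where l = "(a + p) / 2" and p = p and q = "a + r / 2"
        and u = "a + 3 / 4 * r", OF contg])
    show "g s > 0" if "s \<in> {(a + p) / 2..a + 3 / 4 * r}" for s
      using that p \<open>r > 0\<close> by (intro g_pos) auto
  qed (use p \<open>r > 0\<close> in auto)
  define z where "z t = (x t, g (x t))" for t
  have "solution_upto (newton_field v) T z"
    unfolding solution_upto_def
  proof
    fix t assume t: "t \<in> {0..T}"
    have xt: "a < x t" "x t < a + r" using x(4)[OF t] p \<open>r > 0\<close> by auto
    \<comment> \<open>The factor \<open>g\<close> from \<open>x' = g x\<close> cancels the
      denominator in the derivative of \<open>g\<close>, which leaves the second Newton
      equation.\<close>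
    have "((\<lambda>t. g (x t)) has_real_derivative - v (x t) / g (x t) * g (x t)) (at t)"
      by (rule DERIV_chain2[OF g_der[OF xt] x(5)[OF t]])
    then have "((\<lambda>t. g (x t)) has_real_derivative - v (x t)) (at t)"
      using g_pos[OF xt] by simp
    then have "(z has_vector_derivative newton_field v (z t)) (at t)"
      using x(5)[OF t]
      unfolding z_def newton_field_def has_real_derivative_iff_has_vector_derivative
      by (auto simp: has_vector_derivative_def intro!: derivative_eq_intros)
    then show "(z has_vector_derivative newton_field v (z t)) (at t within {0..T})"
      by (rule has_vector_derivative_at_within)
  qed
  then have "dist (z T) (a, 0) < r / 2"
    using stable[of T z] p x(1,2) by (auto simp: z_def)
  moreover have "dist (fst (z T)) a = r / 2"
    using x(3) \<open>r > 0\<close> by (simp add: z_def dist_real_def)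
  ultimately show False
    using dist_fst_le[of "z T" "(a, 0)"] by simp
qed

section \<open>Second derivative test\<close>

text \<open>A positive derivative at its zero \<open>a\<close> makes \<open>v\<close> negative just
  left of \<open>a\<close> and positive just right of it, so \<open>V\<close> first decreases and
  then increases.\<close>

lemma strict_local_min_if_second_deriv_pos:
  fixes V v :: "real \<Rightarrow> real"
  assumes V: "\<And>x. (V has_real_derivative v x) (at x)"
    and "v a = 0" "(v has_real_derivative c) (at a)" "c > 0"
  obtains r where "r > 0" "\<And>x. x \<noteq> a \<Longrightarrow> \<bar>x - a\<bar> \<le> r \<Longrightarrow> V a < V x"
proof -
  obtain d where d: "d > 0" "\<And>h. 0 < h \<Longrightarrow> h < d \<Longrightarrow> 0 < v (a + h)"
    using DERIV_pos_inc_right[OF assms(3,4)] \<open>v a = 0\<close> by auto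
  obtain e where e: "e > 0" "\<And>h. 0 < h \<Longrightarrow> h < e \<Longrightarrow> v (a - h) < 0"
    using DERIV_pos_inc_left[OF assms(3,4)] \<open>v a = 0\<close> by auto
  have contV: "continuous_on S V" for S
    using V by (meson DERIV_isCont continuous_at_imp_continuous_on)
  show thesis
  proof (rule that[of "min d e / 2"])
    fix x assume x: "x \<noteq> a" "\<bar>x - a\<bar> \<le> min d e / 2"
    show "V a < V x"
    proof (cases "a < x")
      case True
      then show ?thesis
      proof (rule DERIV_pos_imp_increasing_open[OF _ _ contV])
        show "\<exists>y. (V has_real_derivative y) (at s) \<and> 0 < y" if "a < s" "s < x" for s
          using d(2)[of "s - a"] V[of s] that x d(1) by (auto split: if_splits simp: min_def)
      qed
    next
      case False
      then have "x < a" using x by simp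
      then show ?thesis
      proof (rule DERIV_neg_imp_decreasing_open[OF _ _ contV])
        show "\<exists>y. (V has_real_derivative y) (at s) \<and> y < 0" if "x < s" "s < a" for s
          using e(2)[of "a - s"] V[of s] that x e(1) by (auto split: if_splits simp: min_def)
      qed
    qed
  qed (use d e in auto)
qed

text \<open>Here \<open>c\<close> is the second derivative of \<open>V\<close> at \<open>a\<close>.
  For \<open>c < 0\<close> the minimum test applied to \<open>- V\<close> gives a strict local
  maximum of \<open>V\<close>, whose right side allows the escape.\<close>

lemma newton_field_stability_by_second_deriv:
  assumes V: "\<And>x. (V has_real_derivative v x) (at x)"
    and v: "v a = 0" "(v has_real_derivative c) (at a)"
  shows "c > 0 \<Longrightarrow> lyapunov_stable (newton_field v) (a, 0)"
    and "c < 0 \<Longrightarrow> lyapunov_unstable (newton_field v) (a, 0)"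
proof -
  assume "c > 0"
  then show "lyapunov_stable (newton_field v) (a, 0)"
    using strict_local_min_if_second_deriv_pos[OF V v]
      newton_field_stable_if_strict_local_min[OF V] by metis
next
  assume "c < 0"
  have "((\<lambda>x. - V x) has_real_derivative - v x) (at x)" for x
    by (intro derivative_intros V)
  moreover have "((\<lambda>x. - v x) has_real_derivative - c) (at a)"
    by (intro derivative_intros v)
  ultimately obtain r where "r > 0" "\<And>x. x \<noteq> a \<Longrightarrow> \<bar>x - a\<bar> \<le> r \<Longrightarrow> - V a < - V x"
    using strict_local_min_if_second_deriv_pos[of "\<lambda>x. - V x" "\<lambda>x. - v x" a "- c"] v \<open>c < 0\<close>
    by auto
  then show "lyapunov_unstable (newton_field v) (a, 0)"
    by (intro newton_field_unstable_if_strict_right_max[OF V, of r]) auto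
qed

section \<open>The charged pendulum\<close>

definition charged_pendulum_potential :: "real \<Rightarrow> real \<Rightarrow> real \<Rightarrow> real" where
  "charged_pendulum_potential \<mu> \<alpha> x = - \<alpha> * cos x - \<mu> / 2 * ln (7 + cos (2 * x))"

definition charged_pendulum_potential_deriv :: "real \<Rightarrow> real \<Rightarrow> real \<Rightarrow> real" where
  "charged_pendulum_potential_deriv \<mu> \<alpha> x = \<alpha> * sin x + \<mu> * sin (2 * x) / (7 + cos (2 * x))"

lemma seven_plus_cos_pos: "7 + cos x > (0::real)"
  using cos_ge_minus_one[of x] by linarith

lemma charged_pendulum_potential_has_deriv:
  "(charged_pendulum_potential \<mu> \<alpha> has_real_derivative charged_pendulum_potential_deriv \<mu> \<alpha> x) (at x)"
proof -
  have D: "7 + cos (2 * x) > 0" by (rule seven_plus_cos_pos)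
  then have "((\<lambda>x. ln (7 + cos (2 * x))) has_real_derivative - 2 * sin (2 * x) / (7 + cos (2 * x))) (at x)"
    by - (rule derivative_eq_intros refl | simp)+
  note DERIV_diff[OF DERIV_cmult[OF DERIV_cos, of "- \<alpha>"] DERIV_cmult[OF this, of "\<mu> / 2"]]
  then show ?thesis
    unfolding charged_pendulum_potential_def charged_pendulum_potential_deriv_def
    by (rule DERIV_cong) (use D in \<open>simp add: divide_simps\<close>)
qed

text \<open>At both points \<open>sin (2 * x) = 0\<close> and \<open>cos (2 * x) = 1\<close>, so the
  quotient contributes \<open>2 * \<mu> / 8\<close>, while \<open>\<alpha> * cos x\<close> takes
  opposite signs.\<close>

lemma charged_pendulum_potential_deriv_at_equilibria:
  "charged_pendulum_potential_deriv \<mu> \<alpha> 0 = 0"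
  "charged_pendulum_potential_deriv \<mu> \<alpha> pi = 0"
  "(charged_pendulum_potential_deriv \<mu> \<alpha> has_real_derivative \<alpha> + \<mu> / 4) (at 0)"
  "(charged_pendulum_potential_deriv \<mu> \<alpha> has_real_derivative - \<alpha> + \<mu> / 4) (at pi)"
  unfolding charged_pendulum_potential_deriv_def
  by (simp, simp, (rule derivative_eq_intros refl | simp)+)

text \<open>The Hamiltonian splits into kinetic and potential energy. Exhibiting the derivatives
  gives each \<open>deriv\<close> its value.\<close>

lemma charged_pendulum_field_eq_newton_field:
  "charged_pendulum_field \<mu> \<alpha> = newton_field (charged_pendulum_potential_deriv \<mu> \<alpha>)"
proof -
  have H: "charged_pendulum_H \<mu> \<alpha> x y = y\<^sup>2 / 2 + charged_pendulum_potential \<mu> \<alpha> x" for x y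
    by (simp add: charged_pendulum_H_def charged_pendulum_potential_def)
  have "deriv (charged_pendulum_H \<mu> \<alpha> x) y = y" for x y
    unfolding H by (rule DERIV_imp_deriv) (auto intro!: derivative_eq_intros)
  moreover have "deriv (\<lambda>u. charged_pendulum_H \<mu> \<alpha> u y) x = charged_pendulum_potential_deriv \<mu> \<alpha> x"
    for x y
    unfolding H
    by (rule DERIV_imp_deriv)
      (auto intro!: derivative_eq_intros charged_pendulum_potential_has_deriv)
  ultimately show ?thesis
    by (simp add: charged_pendulum_field_def hamiltonian_field_def newton_field_def)
qed

theorem mainTheorem1:
  fixes \<mu> \<alpha> :: real
  shows "equilibrium (charged_pendulum_field \<mu> \<alpha>) (0, 0) \<and>
    equilibrium (charged_pendulum_field \<mu> \<alpha>) (pi, 0) \<and>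
    (\<mu> > - 4 * \<alpha> \<longrightarrow> lyapunov_stable (charged_pendulum_field \<mu> \<alpha>) (0, 0)) \<and>
    (\<mu> < - 4 * \<alpha> \<longrightarrow> lyapunov_unstable (charged_pendulum_field \<mu> \<alpha>) (0, 0)) \<and>
    (\<mu> > 4 * \<alpha> \<longrightarrow> lyapunov_stable (charged_pendulum_field \<mu> \<alpha>) (pi, 0)) \<and>
    (\<mu> < 4 * \<alpha> \<longrightarrow> lyapunov_unstable (charged_pendulum_field \<mu> \<alpha>) (pi, 0))"
proof -
  \<comment> \<open>The thresholds come from the sign of the second derivative:
    \<open>\<alpha> + \<mu> / 4\<close> at 0 and \<open>- \<alpha> + \<mu> / 4\<close> at
    \<open>pi\<close>.\<close>
  note at_0 = newton_field_stability_by_second_deriv[OF charged_pendulum_potential_has_deriv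
      charged_pendulum_potential_deriv_at_equilibria(1,3)]
  note at_pi = newton_field_stability_by_second_deriv[OF charged_pendulum_potential_has_deriv
      charged_pendulum_potential_deriv_at_equilibria(2,4)]
  show ?thesis
    unfolding charged_pendulum_field_eq_newton_field
  proof (intro conjI impI)
    show "equilibrium (newton_field (charged_pendulum_potential_deriv \<mu> \<alpha>)) (0, 0)"
      "equilibrium (newton_field (charged_pendulum_potential_deriv \<mu> \<alpha>)) (pi, 0)"
      by (simp_all add: equilibrium_def newton_field_def zero_prod_def
          charged_pendulum_potential_deriv_at_equilibria)
  qed (rule at_0 at_pi, simp)+
qed

end
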